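(* For every $\rho<2$ there exists a directed graph $G=(V,E)$ with vertices $s,t$ and unit edge capacities such that no ordering of $E$ is $\rho$-competitive for the incremental maximum $s$-$t$-flow problem; that is, for every ordering there is $k\in\{1,\dots,|E|\}$ with $f(S^{*}_{k})>\rho f(S_{k})$, where $S_{k}$ is the set of the first $k$ edges of the ordering.
   Context: For $X\subseteq E$, $f(X)$ is the maximum value of an $s$-$t$-flow in $(V,X)$ with unit edge capacities; $S^{*}_{k}$ is a set $X\subseteq E$ with $|X|\leq k$ maximizing $f(X)$. An ordering of $E$ is $\rho$-competitive if $f(S^{*}_{k})\leq\rho f(S_{k})$ for all $k$, where $S_k$ is its prefix of the first $k$ edges. *)

theory Defs
  imports Complex_Main "Graph_Theory.Digraph"
begin

definition is_unit_flow ::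
  "('a, 'b) pre_digraph \<Rightarrow> 'a \<Rightarrow> 'a \<Rightarrow> ('b \<Rightarrow> real) \<Rightarrow> bool" where
  "is_unit_flow G s t g \<longleftrightarrow>
     (\<forall>e\<in>arcs G. 0 \<le> g e \<and> g e \<le> 1) \<and>
     (\<forall>v\<in>verts G - {s, t}. (\<Sum>e\<in>in_arcs G v. g e) = (\<Sum>e\<in>out_arcs G v. g e))"

definition flow_value ::
  "('a, 'b) pre_digraph \<Rightarrow> 'a \<Rightarrow> ('b \<Rightarrow> real) \<Rightarrow> real" where
  "flow_value G s g = (\<Sum>e\<in>out_arcs G s. g e) - (\<Sum>e\<in>in_arcs G s. g e)"

(* On a finite digraph the flows, restricted to the arcs, form a nonempty compact set,
   so the maximum below exists. *)
definition max_flow_value :: "('a, 'b) pre_digraph \<Rightarrow> 'a \<Rightarrow> 'a \<Rightarrow> real" where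
  "max_flow_value G s t =
     (GREATEST r. \<exists>g. is_unit_flow G s t g \<and> r = flow_value G s g)"

(* f(X): the maximum flow value in (V, X) *)
definition flow_obj :: "('a, 'b) pre_digraph \<Rightarrow> 'a \<Rightarrow> 'a \<Rightarrow> 'b set \<Rightarrow> real" where
  "flow_obj G s t X = max_flow_value (G\<lparr>arcs := X\<rparr>) s t"

(* S is one of the possible choices for S*_k; all of them have the same objective value. *)
definition is_opt_arc_set ::
  "('a, 'b) pre_digraph \<Rightarrow> 'a \<Rightarrow> 'a \<Rightarrow> nat \<Rightarrow> 'b set \<Rightarrow> bool" where
  "is_opt_arc_set G s t k S \<longleftrightarrow>
     is_arg_max (flow_obj G s t) (\<lambda>X. X \<subseteq> arcs G \<and> card X \<le> k) S"

definition is_arc_ordering :: "('a, 'b) pre_digraph \<Rightarrow> 'b list \<Rightarrow> bool" where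
  "is_arc_ordering G es \<longleftrightarrow> distinct es \<and> set es = arcs G"

definition competitive_ordering ::
  "real \<Rightarrow> ('a, 'b) pre_digraph \<Rightarrow> 'a \<Rightarrow> 'a \<Rightarrow> 'b list \<Rightarrow> bool" where
  "competitive_ordering \<rho> G s t es \<longleftrightarrow>
     is_arc_ordering G es \<and>
     (\<forall>k\<in>{1..card (arcs G)}. \<forall>S. is_opt_arc_set G s t k S \<longrightarrow>
        flow_obj G s t S \<le> \<rho> * flow_obj G s t (set (take k es)))"

end

theory Submission
  imports Defs
begin

text \<open>
  Take a path \<open>P = s a b t\<close> and add internally disjoint paths of length three from \<open>a\<close> to \<open>t\<close> and
  from \<open>s\<close> to \<open>b\<close>. Then \<open>P\<close> is the unique shortest \<open>s\<close>-\<open>t\<close>-path, so an ordering that does not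
  start with the three arcs of \<open>P\<close> has value 0 against 1 at \<open>k = 3\<close>. The eight arcs other than the
  arc \<open>ab\<close> carry a flow of value 2, and a flow of value greater than 1 needs each of these eight arcs;
  so an ordering that starts with \<open>P\<close> has value 1 against 2 at \<open>k = 8\<close>.
\<close>

text \<open>Vertices: \<open>s = 0\<close>, \<open>a = 1\<close>, \<open>b = 2\<close>, \<open>t = 3\<close>; the detours are \<open>1 4 5 3\<close> and \<open>0 6 7 2\<close>.\<close>

definition detour_network :: "(nat, nat) pre_digraph" where
  "detour_network =
     \<lparr>verts = {0, 1, 2, 3, 4, 5, 6, 7}, arcs = {0, 1, 2, 3, 4, 5, 6, 7, 8},
      tail = (!) [0, 1, 2, 1, 4, 5, 0, 6, 7], head = (!) [1, 2, 3, 4, 5, 3, 6, 7, 2]\<rparr>"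

lemma verts_detour_network: "verts detour_network = {0, 1, 2, 3, 4, 5, 6, 7}"
  and arcs_detour_network: "arcs detour_network = {0, 1, 2, 3, 4, 5, 6, 7, 8}"
  by (simp_all add: detour_network_def)

lemma digraph_detour_network: "digraph detour_network"
  by unfold_locales (auto simp: detour_network_def arc_to_ends_def)

text \<open>Extending \<open>g\<close> by zero outside \<open>X\<close> lets every sum range over
  the fixed set \<open>arcs G\<close>, so that on a concrete graph it unfolds in the same way for
  every \<open>X\<close>.\<close>

lemma sum_arcs_restrict:
  fixes g :: "'b \<Rightarrow> real"
  assumes "X \<subseteq> arcs G" "finite (arcs G)"
  shows "(\<Sum>e\<in>in_arcs (G\<lparr>arcs := X\<rparr>) v. g e) =
           (\<Sum>e\<in>arcs G. if head G e = v then if e \<in> X then g e else 0 else 0)"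
    and "(\<Sum>e\<in>out_arcs (G\<lparr>arcs := X\<rparr>) v. g e) =
           (\<Sum>e\<in>arcs G. if tail G e = v then if e \<in> X then g e else 0 else 0)"
proof -
  have *: "sum g {e \<in> X. P e} = (\<Sum>e\<in>arcs G. if P e then if e \<in> X then g e else 0 else 0)" for P
  proof -
    have "sum g {e \<in> X. P e} = (\<Sum>e\<in>{e \<in> X. P e}. if P e then if e \<in> X then g e else 0 else 0)"
      by (intro sum.cong) auto
    also have "\<dots> = (\<Sum>e\<in>arcs G. if P e then if e \<in> X then g e else 0 else 0)"
      using assms by (intro sum.mono_neutral_left) auto
    finally show ?thesis .
  qed
  show "(\<Sum>e\<in>in_arcs (G\<lparr>arcs := X\<rparr>) v. g e) =
           (\<Sum>e\<in>arcs G. if head G e = v then if e \<in> X then g e else 0 else 0)"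
    using *[of "\<lambda>e. head G e = v"] by (simp add: in_arcs_def)
  show "(\<Sum>e\<in>out_arcs (G\<lparr>arcs := X\<rparr>) v. g e) =
           (\<Sum>e\<in>arcs G. if tail G e = v then if e \<in> X then g e else 0 else 0)"
    using *[of "\<lambda>e. tail G e = v"] by (simp add: out_arcs_def)
qed

text \<open>Arcs 0, 1, 2 form the path \<open>P\<close>; arcs 3, 4, 5 and 6, 7, 8 form the detours.
  The equations are conservation at the vertices 1, 2, 4, 5, 6, 7, in this order. No arc enters
  \<open>s\<close>, so the value is the flow on its two outgoing arcs 0 and 6.\<close>

lemma flow_detour_network:
  fixes g :: "nat \<Rightarrow> real"
  assumes "X \<subseteq> arcs detour_network"
  defines "h \<equiv> \<lambda>e. if e \<in> X then g e else 0"
  shows "is_unit_flow (detour_network\<lparr>arcs := X\<rparr>) 0 3 g \<longleftrightarrow>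
           (\<forall>e\<in>X. 0 \<le> g e \<and> g e \<le> 1) \<and>
           h 0 = h 1 + h 3 \<and> h 1 + h 8 = h 2 \<and>
           h 3 = h 4 \<and> h 4 = h 5 \<and> h 6 = h 7 \<and> h 7 = h 8"
    and "flow_value (detour_network\<lparr>arcs := X\<rparr>) 0 g = h 0 + h 6"
proof -
  have fin: "finite (arcs detour_network)" by (simp add: arcs_detour_network)
  have V: "verts (detour_network\<lparr>arcs := X\<rparr>) - {0, 3} = {1, 2, 4, 5, 6, 7}"
    by (auto simp: verts_detour_network)
  have sums:
    "(\<Sum>e\<in>in_arcs (detour_network\<lparr>arcs := X\<rparr>) v. g e) =
       (\<Sum>e\<in>arcs detour_network. if head detour_network e = v then h e else 0)"
    "(\<Sum>e\<in>out_arcs (detour_network\<lparr>arcs := X\<rparr>) v. g e) =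
       (\<Sum>e\<in>arcs detour_network. if tail detour_network e = v then h e else 0)" for v
    unfolding h_def by (rule sum_arcs_restrict[OF assms(1) fin])+
  show "flow_value (detour_network\<lparr>arcs := X\<rparr>) 0 g = h 0 + h 6"
    unfolding flow_value_def sums by (simp add: detour_network_def)
  show "is_unit_flow (detour_network\<lparr>arcs := X\<rparr>) 0 3 g \<longleftrightarrow>
           (\<forall>e\<in>X. 0 \<le> g e \<and> g e \<le> 1) \<and>
           h 0 = h 1 + h 3 \<and> h 1 + h 8 = h 2 \<and>
           h 3 = h 4 \<and> h 4 = h 5 \<and> h 6 = h 7 \<and> h 7 = h 8"
    unfolding is_unit_flow_def V sums by (auto simp: detour_network_def)
qed

lemma flow_obj_eqI:
  assumes "is_unit_flow (G\<lparr>arcs := X\<rparr>) s t g" "flow_value (G\<lparr>arcs := X\<rparr>) s g = r"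
    and "\<And>g. is_unit_flow (G\<lparr>arcs := X\<rparr>) s t g \<Longrightarrow> flow_value (G\<lparr>arcs := X\<rparr>) s g \<le> r"
  shows "flow_obj G s t X = r"
  unfolding flow_obj_def max_flow_value_def
  using assms by (intro Greatest_equality) auto

text \<open>A missing arc blocks its whole detour. Without 6, 7, 8 the value is \<open>h 0\<close>;
  without 3, 4, 5 it is \<open>h 1 + h 8 = h 2\<close>. Either way a single unit-capacity arc bounds
  it.\<close>

lemma flow_obj_detour_network_missing:
  assumes X: "X \<subseteq> arcs detour_network" "{0, 1, 2} \<subseteq> X" and e: "e \<in> {3..8}" "e \<notin> X"
  shows "flow_obj detour_network 0 3 X = 1"
proof (rule flow_obj_eqI)
  let ?g = "\<lambda>e::nat. if e \<le> 2 then 1 else 0 :: real"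
  show "is_unit_flow (detour_network\<lparr>arcs := X\<rparr>) 0 3 ?g"
    and "flow_value (detour_network\<lparr>arcs := X\<rparr>) 0 ?g = 1"
    using X(2) by (auto simp: flow_detour_network[OF X(1)])
next
  fix g :: "nat \<Rightarrow> real"
  assume "is_unit_flow (detour_network\<lparr>arcs := X\<rparr>) 0 3 g"
  note F = this[unfolded flow_detour_network(1)[OF X(1)]]
  have "e = 3 \<or> e = 4 \<or> e = 5 \<or> e = 6 \<or> e = 7 \<or> e = 8" using e(1) by auto
  moreover have "0 \<le> g 0 \<and> g 0 \<le> 1" "0 \<le> g 2 \<and> g 2 \<le> 1"
    using F X(2) by auto
  ultimately show "flow_value (detour_network\<lparr>arcs := X\<rparr>) 0 g \<le> 1"
    using F X(2) e(2) unfolding flow_detour_network(2)[OF X(1)] by auto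
qed

lemma flow_obj_detour_network_path: "flow_obj detour_network 0 3 {0, 1, 2} = 1"
  by (rule flow_obj_detour_network_missing[where e = 3]) (auto simp: arcs_detour_network)

text \<open>Dropping arc 1 leaves the two arc-disjoint paths 0, 3, 4, 5 and 6, 7, 8, 2. The two arcs
  out of \<open>s\<close> give the upper bound.\<close>

lemma flow_obj_detour_network_two: "flow_obj detour_network 0 3 {0, 2, 3, 4, 5, 6, 7, 8} = 2"
proof (rule flow_obj_eqI)
  let ?X = "{0, 2, 3, 4, 5, 6, 7, 8} :: nat set"
  have X: "?X \<subseteq> arcs detour_network" by (simp add: arcs_detour_network)
  show "is_unit_flow (detour_network\<lparr>arcs := ?X\<rparr>) 0 3 (\<lambda>_. 1)"
    and "flow_value (detour_network\<lparr>arcs := ?X\<rparr>) 0 (\<lambda>_. 1) = 2"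
    by (simp_all add: flow_detour_network[OF X])
  show "flow_value (detour_network\<lparr>arcs := ?X\<rparr>) 0 g \<le> 2"
    if "is_unit_flow (detour_network\<lparr>arcs := ?X\<rparr>) 0 3 g" for g
    using that unfolding flow_detour_network[OF X] by simp
qed

text \<open>The value is \<open>h 1 + h 3 + h 6\<close>, one term for each of the three
  \<open>s\<close>-\<open>t\<close>-paths. Three arcs other than \<open>P\<close> contain none of
  these paths, so each term vanishes.\<close>

lemma flow_obj_detour_network_three:
  assumes X: "X \<subseteq> arcs detour_network" "card X = 3" "X \<noteq> {0, 1, 2}"
  shows "flow_obj detour_network 0 3 X = 0"
proof (rule flow_obj_eqI)
  show "is_unit_flow (detour_network\<lparr>arcs := X\<rparr>) 0 3 (\<lambda>_. 0)"
    and "flow_value (detour_network\<lparr>arcs := X\<rparr>) 0 (\<lambda>_. 0) = 0"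
    by (simp_all add: flow_detour_network[OF X(1)])
next
  fix g :: "nat \<Rightarrow> real"
  assume F: "is_unit_flow (detour_network\<lparr>arcs := X\<rparr>) 0 3 g"
  define h where "h = (\<lambda>e. if e \<in> X then g e else 0)"
  have h: "0 \<le> h e" "e \<notin> X \<Longrightarrow> h e = 0" for e
    using F unfolding flow_detour_network(1)[OF X(1)] by (auto simp: h_def)
  have conservation: "h 0 = h 1 + h 3" "h 1 + h 8 = h 2"
    "h 3 = h 4" "h 4 = h 5" "h 6 = h 7" "h 7 = h 8"
    using F unfolding flow_detour_network(1)[OF X(1)] h_def by blast+
  have fin: "finite X" using X(2) by (simp add: card_ge_0_finite)
  have "\<not> {0, 1, 2} \<subseteq> X"
    using card_subset_eq[OF fin, of "{0, 1, 2}"] X(2,3) by auto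
  then have "h 0 = 0 \<or> h 1 = 0 \<or> h 2 = 0" using h(2) by auto
  \<comment> \<open>By conservation and nonnegativity, \<open>h 1\<close> is at most
    \<open>h 0\<close> and at most \<open>h 2\<close>. The bounds for \<open>h 3\<close> and
    \<open>h 6\<close> below work likewise along the other two paths.\<close>
  then have 1: "h 1 = 0" using conservation h(1)[of 1] h(1)[of 3] h(1)[of 8] by linarith
  have "\<not> {0, 3, 4, 5} \<subseteq> X"
    using card_mono[OF fin, of "{0, 3, 4, 5}"] X(2) by auto
  then have "h 0 = 0 \<or> h 3 = 0 \<or> h 4 = 0 \<or> h 5 = 0" using h(2) by auto
  then have 3: "h 3 = 0" using conservation h(1)[of 1] h(1)[of 3] by linarith
  have "\<not> {2, 6, 7, 8} \<subseteq> X"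
    using card_mono[OF fin, of "{2, 6, 7, 8}"] X(2) by auto
  then have "h 2 = 0 \<or> h 6 = 0 \<or> h 7 = 0 \<or> h 8 = 0" using h(2) by auto
  then have 6: "h 6 = 0" using conservation h(1)[of 1] h(1)[of 8] by linarith
  show "flow_value (detour_network\<lparr>arcs := X\<rparr>) 0 g \<le> 0"
    using 1 3 6 conservation unfolding flow_detour_network(2)[OF X(1)] h_def by linarith
qed

text \<open>There are only finitely many candidate sets, so a maximizer exists; comparing it with a
  chosen \<open>X\<close> avoids computing the optimum.\<close>

lemma is_opt_arc_set_ge:
  assumes "finite (arcs G)" "X \<subseteq> arcs G" "card X \<le> k"
  obtains S where "is_opt_arc_set G s t k S" "flow_obj G s t X \<le> flow_obj G s t S"
proof -
  let ?A = "{X. X \<subseteq> arcs G \<and> card X \<le> k}"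
  have "finite ?A" using assms(1) by simp
  moreover have "X \<in> ?A" using assms by simp
  ultimately have "\<exists>S\<in>?A. \<forall>Y\<in>?A. flow_obj G s t Y \<le> flow_obj G s t S"
    using ex_min_if_finite[of "(\<lambda>Y. - flow_obj G s t Y) ` ?A"]
    by (simp add: not_less) blast
  then obtain S where "S \<in> ?A" "\<forall>Y\<in>?A. flow_obj G s t Y \<le> flow_obj G s t S" ..
  moreover from this have "is_opt_arc_set G s t k S"
    unfolding is_opt_arc_set_def is_arg_max_def by (simp add: not_less)
  ultimately show ?thesis
    using that \<open>X \<in> ?A\<close> by blast
qed

theorem theorem5:
  fixes \<rho> :: real
  assumes "\<rho> < 2"
  shows "\<exists>(G :: (nat, nat) pre_digraph) s t.
           digraph G \<and> s \<in> verts G \<and> t \<in> verts G \<and> s \<noteq> t \<and>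
           (\<forall>es. is_arc_ordering G es \<longrightarrow>
              \<not> competitive_ordering \<rho> G s t es \<and>
              (\<exists>k\<in>{1..card (arcs G)}. \<exists>S. is_opt_arc_set G s t k S \<and>
                 flow_obj G s t S > \<rho> * flow_obj G s t (set (take k es))))"
proof -
  let ?G = detour_network and ?f = "flow_obj detour_network 0 3"
  have fin: "finite (arcs ?G)" and card: "card (arcs ?G) = 9"
    by (simp_all add: arcs_detour_network)
  have main: "\<exists>k\<in>{1..card (arcs ?G)}. \<exists>S. is_opt_arc_set ?G 0 3 k S \<and>
                 ?f S > \<rho> * ?f (set (take k es))"
    if "is_arc_ordering ?G es" for es
  proof -
    have es: "distinct es" "set es = arcs ?G" using that by (auto simp: is_arc_ordering_def)
    then have len: "length es = 9" using card distinct_card by metis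
    have sub: "set (take k es) \<subseteq> arcs ?G" for k using es(2) set_take_subset by metis
    have card_take: "card (set (take k es)) = k" if "k \<le> 9" for k
      using es(1) len that by (simp add: distinct_card)
    show ?thesis
    proof (cases "set (take 3 es) = {0, 1, 2}")
      case False
      then have "?f (set (take 3 es)) = 0"
        using flow_obj_detour_network_three[OF sub] card_take by simp
      moreover obtain S where "is_opt_arc_set ?G 0 3 3 S" "?f {0, 1, 2} \<le> ?f S"
        using is_opt_arc_set_ge[OF fin, of "{0, 1, 2}" 3] by (auto simp: arcs_detour_network)
      ultimately show ?thesis
        using flow_obj_detour_network_path card by (intro bexI[of _ 3] exI[of _ S]) auto
    next
      case True
      then have P: "{0, 1, 2} \<subseteq> set (take 8 es)"
        using set_take_subset_set_take[of 3 8 es] by simp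
      \<comment> \<open>Eight of the nine arcs leave one out, and since \<open>P\<close> is already
        included it lies on a detour.\<close>
      have "set (take 8 es) \<noteq> arcs ?G" using card_take[of 8] card by auto
      then obtain e where "e \<in> arcs ?G" "e \<notin> set (take 8 es)" using sub by blast
      moreover from this P have "e \<in> {3..8}" by (auto simp: arcs_detour_network)
      ultimately have "?f (set (take 8 es)) = 1"
        using flow_obj_detour_network_missing[OF sub P] by simp
      moreover obtain S where
        "is_opt_arc_set ?G 0 3 8 S" "?f {0, 2, 3, 4, 5, 6, 7, 8} \<le> ?f S"
        using is_opt_arc_set_ge[OF fin, of "{0, 2, 3, 4, 5, 6, 7, 8}" 8]
        by (auto simp: arcs_detour_network)
      \<comment> \<open>The prefix has value 1, so \<open>\<rho> < 2\<close> gives the strict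
        inequality against an optimum of at least 2.\<close>
      ultimately show ?thesis
        using flow_obj_detour_network_two card assms
        by (intro bexI[of _ 8] exI[of _ S]) auto
    qed
  qed
  then have "\<not> competitive_ordering \<rho> ?G 0 3 es" if "is_arc_ordering ?G es" for es
    using that unfolding competitive_ordering_def by (meson not_less)
  with main show ?thesis
    using digraph_detour_network
    by (intro exI[of _ ?G] exI[of _ 0] exI[of _ 3]) (simp add: verts_detour_network)
qed

end
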